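(* There exists a Riemannian metric $\tilde g$ on the manifold $M=O(n)\setminus E$ such that $$\nabla_{\tilde g}(-\mathcal{E})=-F\quad\text{on } M,$$ where $\mathcal{E}(Q)=\mathrm{tr}(NQ^TAQ)$ and $\nabla_{\tilde g}$ denotes the Riemannian gradient with respect to $\tilde g$.
   Context: $A=\mathrm{diag}\{\lambda_1,\dots,\lambda_n\}\in\mathbb{R}^{n\times n}$ with $\lambda_1>\lambda_2>\dots>\lambda_n>0$, and $N=\mathrm{diag}\{\mu_1,\dots,\mu_n\}\in\mathbb{R}^{n\times n}$ with $\mu_1>\mu_2>\dots>\mu_n$. $O(n)=\{Q\in\mathbb{R}^{n\times n}: Q^TQ=I_n\}$. $E_j$ denotes the $n\times n$ matrix with entry $1$ at position $(j,j)$ and $0$ elsewhere, and $F$ is the tangent vector field on $O(n)$ $$F(Q)=Q\sum_{j=1}^n\sum_{k=1}^{j-1}\left(E_jQ^TAQE_k-E_kQ^TAQE_j\right).$$ $E=\{\mathrm{diag}\{\varepsilon_1,\dots,\varepsilon_n\}P:\ \varepsilon_i=\pm1,\ P \text{ an } n\times n \text{ permutation matrix}\}$, a finite subset of $O(n)$. *)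

theory Defs
  imports "HOL-Analysis.Analysis"
begin

text \<open>
  Smooth submanifolds of a Euclidean space are represented by their underlying sets, and tangent
  vectors as vectors of the ambient space. The notions below are meant for sets \<open>M\<close> that are
  embedded submanifolds; they refer to \<open>M\<close> only, never to a chosen extension off \<open>M\<close>.
\<close>

primrec k_smooth_on ::
  "nat \<Rightarrow> 'a::euclidean_space set \<Rightarrow> ('a \<Rightarrow> 'b::euclidean_space) \<Rightarrow> bool" where
  "k_smooth_on 0 S f \<longleftrightarrow> continuous_on S f"
| "k_smooth_on (Suc k) S f \<longleftrightarrow>
     (\<forall>x\<in>S. f differentiable (at x)) \<and>
     (\<forall>v. k_smooth_on k S (\<lambda>x. frechet_derivative f (at x) v))"

text \<open>Intended for open \<open>S\<close>: derivatives are taken in the ambient space.\<close>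

definition smooth_on :: "'a::euclidean_space set \<Rightarrow> ('a \<Rightarrow> 'b::euclidean_space) \<Rightarrow> bool" where
  "smooth_on S f \<longleftrightarrow> (\<forall>k. k_smooth_on k S f)"

text \<open>Smoothness on an embedded submanifold: local extendability to a smooth ambient map.\<close>

definition smooth_map_on :: "'a::euclidean_space set \<Rightarrow> ('a \<Rightarrow> 'b::euclidean_space) \<Rightarrow> bool" where
  "smooth_map_on M f \<longleftrightarrow>
     (\<forall>p\<in>M. \<exists>U h. open U \<and> p \<in> U \<and> smooth_on U h \<and> (\<forall>x\<in>U \<inter> M. h x = f x))"

definition smooth_curve_through ::
  "'a::euclidean_space set \<Rightarrow> 'a \<Rightarrow> 'a \<Rightarrow> (real \<Rightarrow> 'a) \<Rightarrow> bool" where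
  "smooth_curve_through M p v \<gamma> \<longleftrightarrow>
     (\<exists>e>0. smooth_on {-e<..<e} \<gamma> \<and> \<gamma> ` {-e<..<e} \<subseteq> M) \<and>
     \<gamma> 0 = p \<and> (\<gamma> has_vector_derivative v) (at 0)"

definition tangent_space :: "'a::euclidean_space set \<Rightarrow> 'a \<Rightarrow> 'a set" where
  "tangent_space M p = {v. \<exists>\<gamma>. smooth_curve_through M p v \<gamma>}"

definition smooth_vector_field_on :: "'a::euclidean_space set \<Rightarrow> ('a \<Rightarrow> 'a) \<Rightarrow> bool" where
  "smooth_vector_field_on M X \<longleftrightarrow> smooth_map_on M X \<and> (\<forall>p\<in>M. X p \<in> tangent_space M p)"

text \<open>
  The values of \<open>g p\<close> outside \<open>tangent_space M p\<close> are irrelevant. Linearity in the second argument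
  follows from symmetry.
\<close>

definition inner_product_on_subspace ::
  "'a::euclidean_space set \<Rightarrow> ('a \<Rightarrow> 'a \<Rightarrow> real) \<Rightarrow> bool" where
  "inner_product_on_subspace T b \<longleftrightarrow>
     (\<forall>u\<in>T. \<forall>v\<in>T. \<forall>w\<in>T. \<forall>r s. b (r *\<^sub>R u + s *\<^sub>R v) w = r * b u w + s * b v w) \<and>
     (\<forall>u\<in>T. \<forall>v\<in>T. b u v = b v u) \<and>
     (\<forall>u\<in>T. u \<noteq> 0 \<longrightarrow> b u u > 0)"

definition riemannian_metric_on ::
  "'a::euclidean_space set \<Rightarrow> ('a \<Rightarrow> 'a \<Rightarrow> 'a \<Rightarrow> real) \<Rightarrow> bool" where
  "riemannian_metric_on M g \<longleftrightarrow>
     (\<forall>p\<in>M. inner_product_on_subspace (tangent_space M p) (g p)) \<and>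
     (\<forall>X Y. smooth_vector_field_on M X \<longrightarrow> smooth_vector_field_on M Y \<longrightarrow>
        smooth_map_on M (\<lambda>p. g p (X p) (Y p)))"

text \<open>
  \<open>V\<close> is the gradient field of \<open>f\<close>: it is tangent and represents the differential of \<open>f\<close>, where
  the differential at \<open>p\<close> applied to \<open>v\<close> is the derivative of \<open>f\<close> along any curve in \<open>M\<close> with
  velocity \<open>v\<close> at \<open>p\<close>. By positive definiteness, \<open>V\<close> is uniquely determined on \<open>M\<close>.
\<close>

definition has_riemannian_gradient_on ::
  "'a::euclidean_space set \<Rightarrow> ('a \<Rightarrow> 'a \<Rightarrow> 'a \<Rightarrow> real) \<Rightarrow> ('a \<Rightarrow> real) \<Rightarrow> ('a \<Rightarrow> 'a) \<Rightarrow> bool" where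
  "has_riemannian_gradient_on M g f V \<longleftrightarrow>
     (\<forall>p\<in>M. V p \<in> tangent_space M p \<and>
        (\<forall>v \<gamma>. smooth_curve_through M p v \<gamma> \<longrightarrow>
           ((\<lambda>t. f (\<gamma> t)) has_real_derivative g p (V p) v) (at 0)))"

text \<open>
  Matrix indices range over a finite linearly ordered type, playing the role of
  \<open>{1 < \<dots> < n}\<close>.
\<close>

definition diag_mat :: "('n::finite \<Rightarrow> real) \<Rightarrow> real^'n^'n" where
  "diag_mat d = (\<chi> i j. if i = j then d i else 0)"

definition perm_mat :: "('n::finite \<Rightarrow> 'n) \<Rightarrow> real^'n^'n" where
  "perm_mat \<pi> = (\<chi> i j. if i = \<pi> j then 1 else 0)"

definition E_mat :: "'n::finite \<Rightarrow> real^'n^'n" where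
  "E_mat l = (\<chi> i j. if i = l \<and> j = l then 1 else 0)"

definition orthogonal_group :: "(real^'n^'n) set" where
  "orthogonal_group = {Q. transpose Q ** Q = mat 1}"

definition signed_permutations :: "(real^'n^'n) set" where
  "signed_permutations =
     {diag_mat \<epsilon> ** perm_mat \<pi> | \<epsilon> \<pi>. (\<forall>i. \<epsilon> i = 1 \<or> \<epsilon> i = -1) \<and> \<pi> permutes UNIV}"

definition F_field ::
  "real^'n::{finite,linorder}^'n::{finite,linorder} \<Rightarrow> real^'n::{finite,linorder}^'n::{finite,linorder} \<Rightarrow>
    real^'n::{finite,linorder}^'n::{finite,linorder}" where
  "F_field A Q = Q ** (\<Sum>j\<in>UNIV. \<Sum>k\<in>{..<j}.
     E_mat j ** transpose Q ** A ** Q ** E_mat k - E_mat k ** transpose Q ** A ** Q ** E_mat j)"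

definition energy :: "real^'n^'n \<Rightarrow> real^'n^'n \<Rightarrow> real^'n^'n \<Rightarrow> real" where
  "energy A N Q = trace (N ** transpose Q ** A ** Q)"

end

theory Submission imports Defs begin

text \<open>
  Put \<open>B = Q\<^sup>T A Q\<close>. A tangent vector at \<open>Q\<close> is \<open>Q S\<close> with \<open>S\<close> skew-symmetric, and the energy has
  derivative \<open>\<Sum>i k. (\<mu> k - \<mu> i) B\<^sub>i\<^sub>k S\<^sub>i\<^sub>k\<close> along it. Moreover \<open>F Q = Q \<Omega>\<close>, where \<open>\<Omega>\<close> is the strictly
  lower minus the strictly upper triangular part of \<open>B\<close>, so that
  \<open>(\<mu> k - \<mu> i) B\<^sub>i\<^sub>k = \<bar>\<mu> i - \<mu> k\<bar> \<Omega>\<^sub>i\<^sub>k\<close>. Hence the left-invariant metric with weights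
  \<open>\<bar>\<mu> i - \<mu> k\<bar>\<close> works; it is defined on all of \<open>O(n)\<close>. Curves with prescribed velocity are products
  of plane rotations.
\<close>

section \<open>Calculus of smooth maps on open sets\<close>

text \<open>Derivatives at \<open>x\<close> see values in a whole neighbourhood of \<open>x\<close>;
  openness of \<open>S\<close> makes \<open>f\<close> and \<open>g\<close> agree there, so their
  derivatives coincide and the induction passes to them.\<close>

lemma k_smooth_on_cong:
  assumes "open S" "k_smooth_on k S f" "\<And>x. x \<in> S \<Longrightarrow> f x = g x"
  shows "k_smooth_on k S g"
  using assms(2,3)
proof (induction k arbitrary: f g)
  case 0
  then show ?case by (auto cong: continuous_on_cong)
next
  case (Suc k)
  have fd: "(f has_derivative frechet_derivative f (at x)) (at x)" if "x \<in> S" for x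
    using Suc.prems(1) that by (simp add: frechet_derivative_works)
  have gd: "(g has_derivative frechet_derivative f (at x)) (at x)" if "x \<in> S" for x
    using has_derivative_transform_within_open[OF fd[OF that] assms(1) that] Suc.prems(2) by auto
  then have "frechet_derivative f (at x) = frechet_derivative g (at x)" if "x \<in> S" for x
    using that frechet_derivative_at by blast
  moreover have "g differentiable (at x)" if "x \<in> S" for x
    using gd[OF that] by (auto simp: differentiable_def)
  ultimately show ?case
    using Suc.prems(1) Suc.IH[of "\<lambda>x. frechet_derivative f (at x) v"
        "\<lambda>x. frechet_derivative g (at x) v" for v]
    by auto
qed

text \<open>\<open>frechet_derivative\<close> is defined by choice. Uniqueness of derivatives allows
  any explicit formula \<open>f'\<close> to take its place, which is how all later smoothness proofs
  proceed.\<close>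

lemma k_smooth_on_SucI:
  assumes "open S" "\<And>x. x \<in> S \<Longrightarrow> (f has_derivative f' x) (at x)"
    and "\<And>v. k_smooth_on k S (\<lambda>x. f' x v)"
  shows "k_smooth_on (Suc k) S f"
proof -
  have "frechet_derivative f (at x) = f' x" if "x \<in> S" for x
    using frechet_derivative_at[OF assms(2)[OF that]] by simp
  then show ?thesis
    using assms k_smooth_on_cong[OF assms(1,3)] by (auto simp: differentiable_def)
qed

lemma k_smooth_on_SucD:
  assumes "k_smooth_on (Suc k) S f"
  shows "k_smooth_on k S f"
  using assms
proof (induction k arbitrary: f)
  case 0
  then show ?case
    by (auto intro!: continuous_at_imp_continuous_on differentiable_imp_continuous_within)
next
  case (Suc k)
  then show ?case by simp
qed

lemma k_smooth_on_subset:
  assumes "k_smooth_on k S f" "T \<subseteq> S"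
  shows "k_smooth_on k T f"
  using assms(1)
proof (induction k arbitrary: f)
  case 0
  then show ?case using assms(2) continuous_on_subset by auto
next
  case (Suc k)
  then show ?case using assms(2) by auto
qed

lemma k_smooth_on_const: "open S \<Longrightarrow> k_smooth_on k S (\<lambda>x. c)"
proof (induction k arbitrary: c)
  case 0
  then show ?case by simp
next
  case (Suc k)
  then show ?case by (intro k_smooth_on_SucI[where f' = "\<lambda>_ _. 0"]) auto
qed

lemma k_smooth_on_id: "open S \<Longrightarrow> k_smooth_on k S (\<lambda>x. x)"
proof (cases k)
  case (Suc m)
  assume "open S"
  then show ?thesis
    unfolding Suc by (intro k_smooth_on_SucI[where f' = "\<lambda>_ v. v"] k_smooth_on_const) auto
qed simp

lemma k_smooth_on_add:
  assumes "open S" "k_smooth_on k S f" "k_smooth_on k S g"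
  shows "k_smooth_on k S (\<lambda>x. f x + g x)"
  using assms(2,3)
proof (induction k arbitrary: f g)
  case 0
  then show ?case by (auto intro: continuous_on_add)
next
  case (Suc k)
  then show ?case
    by (intro k_smooth_on_SucI[where
          f' = "\<lambda>x v. frechet_derivative f (at x) v + frechet_derivative g (at x) v"]
        has_derivative_add assms(1)) (auto simp: frechet_derivative_works)
qed

text \<open>The product rule yields two terms of the same bilinear shape, so the induction leaves
  \<open>f\<close> and \<open>g\<close> arbitrary. The undifferentiated factors are lowered to order
  \<open>k\<close> by \<open>k_smooth_on_SucD\<close>.\<close>

lemma k_smooth_on_bilinear:
  assumes "bounded_bilinear b" "open S" "k_smooth_on k S f" "k_smooth_on k S g"
  shows "k_smooth_on k S (\<lambda>x. b (f x) (g x))"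
  using assms(3,4)
proof (induction k arbitrary: f g)
  case 0
  then show ?case by (auto intro: bounded_bilinear.continuous_on[OF assms(1)])
next
  case (Suc k)
  have "k_smooth_on k S f" "k_smooth_on k S g"
    using Suc.prems k_smooth_on_SucD by blast+
  then show ?case
    using Suc
    by (intro k_smooth_on_SucI[where f' = "\<lambda>x v. b (f x) (frechet_derivative g (at x) v)
          + b (frechet_derivative f (at x) v) (g x)"]
        bounded_bilinear.FDERIV[OF assms(1)] k_smooth_on_add assms(2))
      (auto simp: frechet_derivative_works)
qed

text \<open>This family is closed under differentiation: in direction \<open>v\<close> the
  coefficients \<open>(a, u, w)\<close> become \<open>(0, v c w, - v c u)\<close>. Hence the
  induction generalises over all three.\<close>

lemma k_smooth_on_trig:
  assumes "open S"
  shows "k_smooth_on k S (\<lambda>t. a + cos (c * t) *\<^sub>R u + sin (c * t) *\<^sub>R w)"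
proof (induction k arbitrary: a u w)
  case 0
  then show ?case by (auto intro!: continuous_intros)
next
  case (Suc k)
  show ?case
  proof (rule k_smooth_on_SucI[OF assms])
    show "((\<lambda>t. a + cos (c * t) *\<^sub>R u + sin (c * t) *\<^sub>R w) has_derivative
        (\<lambda>v. 0 + cos (c * t) *\<^sub>R ((v * c) *\<^sub>R w) + sin (c * t) *\<^sub>R ((- v * c) *\<^sub>R u))) (at t)" for t
      by (auto intro!: derivative_eq_intros simp: algebra_simps)
  qed (rule Suc)
qed

section \<open>Matrix operations as bounded linear and bilinear maps\<close>

lemma bounded_bilinear_matrix_mult:
  "bounded_bilinear ((**) :: real^'n^'m \<Rightarrow> real^'p^'n \<Rightarrow> real^'p^'m)"
  unfolding bilinear_conv_bounded_bilinear[symmetric] bilinear_def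
  by (auto intro!: linearI
      simp: matrix_matrix_mult_def vec_eq_iff sum.distrib algebra_simps sum_distrib_left)

lemma bounded_linear_transpose:
  "bounded_linear (transpose :: real^'n^'m \<Rightarrow> real^'m^'n)"
  unfolding linear_conv_bounded_linear[symmetric]
  by (auto intro!: linearI simp: transpose_def vec_eq_iff)

lemma bounded_bilinear_transpose_mult:
  "bounded_bilinear (\<lambda>(X :: real^'n^'m) (Y :: real^'p^'m). transpose X ** Y)"
  using bounded_bilinear.comp1[OF bounded_bilinear_matrix_mult bounded_linear_transpose] .

lemma matrix_mult_entry: "(X ** Y) $ i $ j = (\<Sum>k\<in>UNIV. X $ i $ k * Y $ k $ j)"
  by (simp add: matrix_matrix_mult_def)

lemmas matrix_expand =
  bounded_bilinear.add_left[OF bounded_bilinear_matrix_mult]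
  bounded_bilinear.add_right[OF bounded_bilinear_matrix_mult]
  bounded_bilinear.diff_left[OF bounded_bilinear_matrix_mult]
  bounded_bilinear.diff_right[OF bounded_bilinear_matrix_mult]
  bounded_bilinear.minus_left[OF bounded_bilinear_matrix_mult]
  bounded_bilinear.minus_right[OF bounded_bilinear_matrix_mult]
  bounded_bilinear.scaleR_left[OF bounded_bilinear_matrix_mult]
  bounded_bilinear.scaleR_right[OF bounded_bilinear_matrix_mult]
  bounded_bilinear.zero_left[OF bounded_bilinear_matrix_mult]
  bounded_bilinear.zero_right[OF bounded_bilinear_matrix_mult]

lemmas transpose_expand =
  linear_add[OF bounded_linear.linear[OF bounded_linear_transpose]]
  linear_diff[OF bounded_linear.linear[OF bounded_linear_transpose]]
  linear_neg[OF bounded_linear.linear[OF bounded_linear_transpose]]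
  linear_scale[OF bounded_linear.linear[OF bounded_linear_transpose]]

section \<open>Matrix units and plane rotations\<close>

definition unit_mat :: "'m::finite \<Rightarrow> 'n::finite \<Rightarrow> real^'n^'m" where
  "unit_mat i j = (\<chi> a b. if a = i \<and> b = j then 1 else 0)"

lemma unit_mat_mult: "unit_mat i j ** unit_mat k l = (if j = k then unit_mat i l else 0)"
proof -
  \<comment> \<open>With the test on the summation index \<open>m\<close> outermost, the sum over
    \<open>m\<close> collapses to a single term. The same rewriting recurs in the entrywise
    computations below.\<close>
  have "unit_mat i j $ a $ m * unit_mat k l $ m $ b
      = (if m = j then if a = i \<and> j = k \<and> b = l then 1 else 0 else 0)" for a m b
    by (auto simp: unit_mat_def)
  then have "(unit_mat i j ** unit_mat k l) $ a $ b
      = (if a = i \<and> j = k \<and> b = l then 1 else 0)" for a b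
    by (simp only: matrix_mult_entry) simp
  then show ?thesis
    by (simp add: vec_eq_iff unit_mat_def)
qed

lemma transpose_unit_mat: "transpose (unit_mat i j) = unit_mat j i"
  by (auto simp: vec_eq_iff transpose_def unit_mat_def)

text \<open>Multiplying by \<open>E_mat j\<close> on the left keeps only row \<open>j\<close>, and
  by \<open>E_mat k\<close> on the right only column \<open>k\<close>. This evaluates the summands
  of \<open>F_field\<close>.\<close>

lemma E_mat_sandwich: "E_mat j ** X ** E_mat k = X $ j $ k *\<^sub>R unit_mat j k"
proof -
  have left: "E_mat j $ a $ m * X $ m $ b = (if m = j then if a = j then X $ j $ b else 0 else 0)"
    for a m b
    by (auto simp: E_mat_def)
  have right: "(if a = j then X $ j $ m else 0) * E_mat k $ m $ b
      = (if m = k then if a = j \<and> b = k then X $ j $ k else 0 else 0)" for a m b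
    by (auto simp: E_mat_def)
  have "(E_mat j ** X) $ a $ b = (if a = j then X $ j $ b else 0)" for a b
    by (simp only: matrix_mult_entry left) simp
  then have "(E_mat j ** X ** E_mat k) $ a $ b = (if a = j \<and> b = k then X $ j $ k else 0)" for a b
    by (simp only: matrix_mult_entry[of _ "E_mat k"] right) simp
  then show ?thesis
    by (simp add: vec_eq_iff unit_mat_def)
qed

text \<open>Rodrigues' formula for \<open>exp (\<theta> J)\<close> when \<open>J\<^sup>3 = -J\<close>.\<close>

lemma rodrigues_orthogonal:
  fixes J :: "real^'n^'n"
  assumes "transpose J = - J" "J ** J ** J = - J"
  shows "(mat 1 + J ** J) + cos \<theta> *\<^sub>R (- (J ** J)) + sin \<theta> *\<^sub>R J \<in> orthogonal_group"
proof -
  define P where "P = J ** J"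
  \<comment> \<open>These relations, with symmetry of \<open>P\<close>, make \<open>- P\<close> an
    orthogonal projection and \<open>mat 1 + P\<close> the complementary one: the curve fixes the
    range of the latter and rotates that of the former.\<close>
  have PJ: "P ** J = - J" "J ** P = - J" "P ** P = - P" "J ** J = P"
    using assms(2) by (simp_all add: P_def matrix_mul_assoc matrix_expand)
  have tP: "transpose P = P"
    by (simp add: P_def matrix_transpose_mul assms matrix_expand)
  have "transpose (mat 1 + P + cos \<theta> *\<^sub>R (- P) + sin \<theta> *\<^sub>R J) **
      (mat 1 + P + cos \<theta> *\<^sub>R (- P) + sin \<theta> *\<^sub>R J)
    = mat 1"
    \<comment> \<open>The mixed terms cancel, and the cosine and sine squares add up to 1.\<close>
    by (simp add: transpose_expand tP assms(1) transpose_mat matrix_expand PJ)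
      (simp add: algebra_simps, simp flip: scaleR_left_distrib)
  then show ?thesis
    by (simp add: orthogonal_group_def P_def)
qed

section \<open>Curves in the orthogonal group with prescribed velocity\<close>

text \<open>Curves are based at the identity and defined for all times, so that they can be
  multiplied pointwise; other base points are reached by left translation.\<close>

definition orthogonal_curve :: "real^'n^'n \<Rightarrow> (real \<Rightarrow> real^'n^'n) \<Rightarrow> bool" where
  "orthogonal_curve S \<gamma> \<longleftrightarrow> (\<forall>k. k_smooth_on k UNIV \<gamma>) \<and> range \<gamma> \<subseteq> orthogonal_group \<and>
     \<gamma> 0 = mat 1 \<and> (\<gamma> has_vector_derivative S) (at 0)"

lemma orthogonal_group_mult:
  assumes "X \<in> orthogonal_group" "Y \<in> orthogonal_group"
  shows "X ** Y \<in> orthogonal_group"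
proof -
  have "transpose (X ** Y) ** (X ** Y) = transpose Y ** (transpose X ** X) ** Y"
    by (simp add: matrix_transpose_mul matrix_mul_assoc)
  then show ?thesis
    using assms by (simp add: orthogonal_group_def)
qed

lemma orthogonal_group_inverse:
  assumes "X \<in> orthogonal_group"
  shows "transpose X ** X = mat 1" "X ** transpose X = mat 1"
  using assms by (auto simp: orthogonal_group_def matrix_left_right_inverse)

text \<open>For distinct indices the curve rotates the plane of coordinates \<open>j\<close> and
  \<open>k\<close> with angular speed \<open>c\<close>; for equal ones the velocity is 0 and a
  constant curve serves.\<close>

lemma orthogonal_curve_unit:
  fixes j k :: "'n::finite"
  shows "\<exists>\<gamma>. orthogonal_curve (c *\<^sub>R (unit_mat j k - unit_mat k j)) \<gamma>"
proof (cases "j = k")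
  case True
  have "orthogonal_curve 0 (\<lambda>_. mat 1)"
    by (auto simp: orthogonal_curve_def orthogonal_group_def transpose_mat k_smooth_on_const)
  then show ?thesis using True by auto
next
  case False
  define J :: "real^'n^'n" where "J = unit_mat j k - unit_mat k j"
  have J: "transpose J = - J" "J ** J ** J = - J"
    using False by (simp_all add: J_def transpose_expand transpose_unit_mat matrix_expand
        unit_mat_mult)
  define \<gamma> where
    "\<gamma> t = (mat 1 + J ** J) + cos (c * t) *\<^sub>R (- (J ** J)) + sin (c * t) *\<^sub>R J" for t
  have "(\<gamma> has_vector_derivative c *\<^sub>R J) (at 0)"
    unfolding \<gamma>_def has_vector_derivative_def
    by (auto intro!: derivative_eq_intros simp: algebra_simps)
  moreover have "k_smooth_on m UNIV \<gamma>" for m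
    unfolding \<gamma>_def by (rule k_smooth_on_trig) simp
  ultimately have "orthogonal_curve (c *\<^sub>R J) \<gamma>"
    using rodrigues_orthogonal[OF J] by (auto simp: orthogonal_curve_def \<gamma>_def)
  then show ?thesis by (auto simp: J_def)
qed

text \<open>Both factors equal the identity at time 0, so the product rule simply adds the
  velocities, even if the matrices do not commute.\<close>

lemma orthogonal_curve_mult:
  assumes "orthogonal_curve S \<gamma>" "orthogonal_curve T \<delta>"
  shows "orthogonal_curve (S + T) (\<lambda>t. \<gamma> t ** \<delta> t)"
  using assms bounded_bilinear.has_vector_derivative[OF bounded_bilinear_matrix_mult,
      of \<gamma> S 0 UNIV \<delta> T]
  by (auto simp: orthogonal_curve_def add.commute
      intro!: orthogonal_group_mult k_smooth_on_bilinear[OF bounded_bilinear_matrix_mult])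

lemma orthogonal_curve_sum:
  assumes "\<And>i. i \<in> I \<Longrightarrow> \<exists>\<gamma>. orthogonal_curve (S i) \<gamma>"
  shows "\<exists>\<gamma>. orthogonal_curve (sum S I) \<gamma>"
  using assms
proof (induction I rule: infinite_finite_induct)
  case (insert i I)
  obtain \<gamma> \<delta> where "orthogonal_curve (S i) \<gamma>" "orthogonal_curve (sum S I) \<delta>"
    using insert.IH insert.prems by blast
  then show ?case
    using orthogonal_curve_mult insert.hyps by fastforce
\<comment> \<open>In the remaining cases, \<open>I\<close> empty or infinite, the sum is 0, and a
  curve of speed \<open>c = 0\<close> has this velocity.\<close>
qed (use orthogonal_curve_unit[where c = 0] in simp_all)

lemma skew_entry:
  fixes S :: "real^'n^'n"
  assumes "transpose S = - S"
  shows "S $ b $ a = - S $ a $ b"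
  using arg_cong[OF assms, of "\<lambda>X. X $ a $ b"] by (simp add: transpose_def)

lemma orthogonal_curve_exists:
  fixes S :: "real^'n^'n"
  assumes "transpose S = - S"
  shows "\<exists>\<gamma>. orthogonal_curve S \<gamma>"
proof -
  note skew = skew_entry[OF assms]
  \<comment> \<open>The sum runs over ordered pairs, so each plane occurs twice with equal
    contributions; hence the factor one half.\<close>
  have "S = (\<Sum>j\<in>UNIV. \<Sum>k\<in>UNIV. (S $ j $ k / 2) *\<^sub>R (unit_mat j k - unit_mat k j))"
  proof -
    have *: "(S $ j $ k / 2) * ((unit_mat j k :: real^'n^'n) $ a $ b)
        = (if k = b then if j = a then S $ a $ b / 2 else 0 else 0)"
      "(S $ j $ k / 2) * ((unit_mat k j :: real^'n^'n) $ a $ b)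
        = (if k = a then if j = b then S $ b $ a / 2 else 0 else 0)" for j k a b
      by (auto simp: unit_mat_def)
    have "(\<Sum>j\<in>UNIV. \<Sum>k\<in>UNIV. (S $ j $ k / 2) *\<^sub>R (unit_mat j k - unit_mat k j)) $ a $ b
        = S $ a $ b / 2 - S $ b $ a / 2" for a b
      by (simp only: sum_component vector_scaleR_component vector_minus_component
          right_diff_distrib real_scaleR_def * sum_subtractf) simp
    moreover have "S $ a $ b / 2 - S $ b $ a / 2 = S $ a $ b" for a b
      using skew[of b a] by simp
    ultimately show ?thesis
      by (simp only: vec_eq_iff simp_thms)
  qed
  moreover have "\<exists>\<gamma>. orthogonal_curve
      (\<Sum>j\<in>UNIV. \<Sum>k\<in>UNIV. (S $ j $ k / 2) *\<^sub>R (unit_mat j k - unit_mat k j)) \<gamma>"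
    by (intro orthogonal_curve_sum orthogonal_curve_unit)
  ultimately show ?thesis
    by (simp only:)
qed

section \<open>Tangent vectors\<close>

text \<open>A finite set is closed, so a continuous curve that starts outside it stays outside for a
  short time.\<close>

lemma finite_signed_permutations: "finite (signed_permutations :: (real^'n^'n) set)"
proof -
  have "finite {\<epsilon> :: 'n \<Rightarrow> real. \<forall>i. \<epsilon> i = 1 \<or> \<epsilon> i = -1}"
    using finite_PiE[of "UNIV :: 'n set" "\<lambda>_. {1, -1 :: real}"] by (simp add: PiE_def Pi_def)
  moreover have "(signed_permutations :: (real^'n^'n) set) \<subseteq>
      (\<lambda>(\<epsilon>, \<pi>). diag_mat \<epsilon> ** perm_mat \<pi>) ` ({\<epsilon>. \<forall>i. \<epsilon> i = 1 \<or> \<epsilon> i = -1} \<times> UNIV)"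
    by (auto simp: signed_permutations_def)
  ultimately show ?thesis
    using finite_subset by (fastforce intro: finite_imageI finite_cartesian_product)
qed

text \<open>Left translation by \<open>p\<close> turns a curve through the identity with velocity
  \<open>S\<close> into one through \<open>p\<close> with velocity \<open>p ** S\<close>; shrinking
  its time interval keeps it off the removed points.\<close>

lemma skew_in_tangent_space:
  fixes S p :: "real^'n^'n"
  assumes S: "transpose S = - S" and p: "p \<in> orthogonal_group - signed_permutations"
  shows "p ** S \<in> tangent_space (orthogonal_group - signed_permutations) p"
proof -
  obtain \<gamma> where \<gamma>: "orthogonal_curve S \<gamma>"
    using orthogonal_curve_exists[OF S] by blast
  define \<delta> where "\<delta> = (\<lambda>t. p ** \<gamma> t)"
  have smooth: "k_smooth_on k UNIV \<delta>" for k
    using \<gamma> unfolding \<delta>_def orthogonal_curve_def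
    by (intro k_smooth_on_bilinear[OF bounded_bilinear_matrix_mult] k_smooth_on_const) auto
  have deriv: "(\<delta> has_vector_derivative p ** S) (at 0)"
    using \<gamma> bounded_linear.has_vector_derivative[OF
        bounded_bilinear.bounded_linear_right[OF bounded_bilinear_matrix_mult]]
    by (auto simp: \<delta>_def orthogonal_curve_def)
  have \<delta>0: "\<delta> 0 = p"
    using \<gamma> by (simp add: \<delta>_def orthogonal_curve_def)
  have "open (\<delta> -` (- signed_permutations))"
    using smooth[of 0] finite_imp_closed[OF finite_signed_permutations]
    by (intro open_vimage) auto
  then obtain e where "e > 0" and e: "ball 0 e \<subseteq> \<delta> -` (- signed_permutations)"
    using p \<delta>0 by (force simp: open_contains_ball)
  have "\<delta> ` {-e<..<e} \<subseteq> orthogonal_group - signed_permutations"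
  proof -
    have "\<delta> t \<in> orthogonal_group" for t
      using \<gamma> p by (auto simp: \<delta>_def orthogonal_curve_def intro!: orthogonal_group_mult)
    moreover have "{-e<..<e} = ball 0 e" by (auto simp: dist_real_def)
    ultimately show ?thesis using e by auto
  qed
  moreover have "smooth_on {-e<..<e} \<delta>"
    using smooth k_smooth_on_subset unfolding smooth_on_def by blast
  ultimately show ?thesis
    using \<open>e > 0\<close> deriv \<delta>0 by (auto simp: tangent_space_def smooth_curve_through_def)
qed

text \<open>Differentiate the constraint \<open>transpose (\<gamma> t) ** \<gamma> t = mat 1\<close>
  at 0. This is the converse of \<open>skew_in_tangent_space\<close>.\<close>

lemma smooth_curve_through_skew:
  fixes p v :: "real^'n^'n"
  assumes \<gamma>: "smooth_curve_through M p v \<gamma>" and M: "M \<subseteq> orthogonal_group"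
  shows "transpose (transpose p ** v) = - (transpose p ** v)"
proof -
  obtain e where e: "e > 0" "\<gamma> ` {-e<..<e} \<subseteq> M" and \<gamma>0: "\<gamma> 0 = p"
    and deriv: "(\<gamma> has_vector_derivative v) (at 0)"
    using \<gamma> by (auto simp: smooth_curve_through_def)
  have "((\<lambda>t. transpose (\<gamma> t) ** \<gamma> t) has_vector_derivative
      transpose p ** v + transpose v ** p) (at 0)"
    using bounded_bilinear.has_vector_derivative[OF bounded_bilinear_transpose_mult deriv deriv] \<gamma>0
    by simp
  moreover have "transpose (\<gamma> t) ** \<gamma> t = mat 1" if "t \<in> {-e<..<e}" for t
  proof -
    have "\<gamma> t \<in> orthogonal_group" using e(2) M that by blast
    then show ?thesis by (rule orthogonal_group_inverse)
  qed
  then have "((\<lambda>t. transpose (\<gamma> t) ** \<gamma> t) has_vector_derivative 0) (at 0)"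
    using e by (intro has_vector_derivative_transform_within_open[
          OF has_vector_derivative_const[of "mat 1"], of "{-e<..<e}"]) auto
  ultimately have "transpose p ** v + transpose v ** p = 0"
    using vector_derivative_unique_at by blast
  then show ?thesis
    by (simp add: matrix_transpose_mul transpose_transpose eq_neg_iff_add_eq_0 add.commute)
qed

section \<open>The vector field in triangular form\<close>

text \<open>For \<open>k < j\<close> the first summand puts entry \<open>(j, k)\<close> of
  \<open>B\<close> below the diagonal, and the second puts entry \<open>(k, j)\<close> above it with
  a minus sign.\<close>

lemma F_field_eq_triangular:
  fixes A Q :: "real^'n::{finite,linorder}^'n::{finite,linorder}"
  defines "B \<equiv> transpose Q ** A ** Q"
  shows "F_field A Q = Q **
    (\<chi> a b. if b < a then B $ a $ b else if a < b then - B $ a $ b else 0)"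
proof -
  have sandwich: "E_mat j ** transpose Q ** A ** Q ** E_mat k = B $ j $ k *\<^sub>R unit_mat j k" for j k
    using E_mat_sandwich[of j B k] by (simp add: B_def matrix_mul_assoc)
  have *: "B $ j $ k * (unit_mat j k $ a $ b)
        = (if k = b then if j = a then B $ a $ b else 0 else 0)"
      "B $ k $ j * (unit_mat k j $ a $ b)
        = (if k = a then if j = b then B $ a $ b else 0 else 0)" for j k a b :: 'n
    by (auto simp: unit_mat_def)
  have "(\<Sum>j\<in>UNIV. \<Sum>k\<in>{..<j}. B $ j $ k *\<^sub>R unit_mat j k - B $ k $ j *\<^sub>R unit_mat k j) =
    (\<chi> a b. if b < a then B $ a $ b else if a < b then - B $ a $ b else 0)"
    (is "?L = ?R")
  proof -
    have "?L $ a $ b = ?R $ a $ b" for a b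
    proof -
      have "?L $ a $ b =
        (\<Sum>j\<in>UNIV. if j = a then if b < j then B $ a $ b else 0 else 0) -
        (\<Sum>j\<in>UNIV. if j = b then if a < j then B $ a $ b else 0 else 0)"
        by (simp only: sum_component vector_scaleR_component vector_minus_component
          real_scaleR_def * sum_subtractf) (intro arg_cong2[where f = "(-)"] sum.cong refl; simp)
      then show ?thesis by auto
    qed
    then show ?thesis by (simp add: vec_eq_iff)
  qed
  then show ?thesis
    unfolding F_field_def sandwich by simp
qed

lemma trace_diag_mat_mult: "trace (diag_mat d ** X) = (\<Sum>i\<in>UNIV. d i * X $ i $ i)"
proof -
  have "diag_mat d $ i $ k * X $ k $ i = (if k = i then d i * X $ i $ i else 0)" for i k
    by (auto simp: diag_mat_def)
  then show ?thesis
    by (simp only: trace_def matrix_mult_entry) simp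
qed

section \<open>The weighted form and the differential of the energy\<close>

definition weighted_form ::
  "('n::finite \<Rightarrow> real) \<Rightarrow> real^'n^'n \<Rightarrow> real^'n^'n \<Rightarrow> real" where
  "weighted_form \<mu> S T = (\<Sum>i\<in>UNIV. \<Sum>k\<in>UNIV. \<bar>\<mu> i - \<mu> k\<bar> * S $ i $ k * T $ i $ k)"

lemma bounded_bilinear_weighted_form: "bounded_bilinear (weighted_form \<mu>)"
  unfolding bilinear_conv_bounded_bilinear[symmetric] bilinear_def
  by (auto intro!: linearI simp: weighted_form_def sum.distrib algebra_simps sum_distrib_left)

text \<open>The weights vanish on the diagonal, but so does a skew matrix. A nonzero entry thus lies
  off the diagonal, where injectivity of \<open>\<mu>\<close> makes its weight positive; no summand
  is negative.\<close>

lemma weighted_form_pos: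
  fixes S :: "real^'n^'n"
  assumes "inj \<mu>" "transpose S = - S" "S \<noteq> 0"
  shows "weighted_form \<mu> S S > 0"
proof -
  note skew = skew_entry[OF assms(2)]
  obtain i k where ik: "S $ i $ k \<noteq> 0"
    using assms(3) by (auto simp: vec_eq_iff)
  then have "i \<noteq> k" using skew[of i i] by auto
  then have pos: "\<bar>\<mu> i - \<mu> k\<bar> * S $ i $ k * S $ i $ k > 0"
    unfolding mult.assoc using ik assms(1) \<open>i \<noteq> k\<close>
    by (intro mult_pos_pos[of "\<bar>_\<bar>"]) (auto simp: inj_eq zero_less_mult_iff)
  have nonneg: "\<bar>\<mu> a - \<mu> b\<bar> * S $ a $ b * S $ a $ b \<ge> 0" for a b
    by (simp add: mult.assoc)
  have "(\<Sum>k\<in>UNIV. \<bar>\<mu> i - \<mu> k\<bar> * S $ i $ k * S $ i $ k) > 0"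
    by (rule sum_pos2[of _ k]) (simp_all only: pos nonneg finite UNIV_I)
  then show ?thesis
    unfolding weighted_form_def
    by (rule sum_pos2[of _ i, rotated 2]) (simp_all add: nonneg sum_nonneg)
qed

lemma energy_derivative:
  fixes p v :: "real^'n^'n"
  assumes deriv: "(\<gamma> has_vector_derivative v) (at t)" and p: "\<gamma> t = p"
  shows "((\<lambda>t. energy A N (\<gamma> t)) has_real_derivative
    trace (N ** (transpose p ** A ** v + transpose v ** A ** p))) (at t)"
proof -
  note bil = bounded_bilinear_matrix_mult
  have "((\<lambda>t. transpose (\<gamma> t) ** (A ** \<gamma> t)) has_vector_derivative
      transpose p ** (A ** v) + transpose v ** (A ** p)) (at t)"
    using bounded_bilinear.has_vector_derivative[OF bounded_bilinear_transpose_mult deriv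
        bounded_linear.has_vector_derivative[OF bounded_bilinear.bounded_linear_right[OF bil] deriv,
          of A]] p
    by simp
  moreover have "bounded_linear (\<lambda>X. trace (N ** X))"
    unfolding linear_conv_bounded_linear[symmetric]
    by (auto intro!: linearI simp: matrix_expand trace_add)
      (simp add: trace_def sum_distrib_left)
  ultimately have "((\<lambda>t. trace (N ** (transpose (\<gamma> t) ** (A ** \<gamma> t)))) has_vector_derivative
      trace (N ** (transpose p ** (A ** v) + transpose v ** (A ** p)))) (at t)"
    using bounded_linear.has_vector_derivative by blast
  then show ?thesis
    by (simp add: has_real_derivative_iff_has_vector_derivative energy_def matrix_mul_assoc)
qed

text \<open>With \<open>v = p ** S\<close> the matrix next to \<open>diag_mat mu\<close> becomes the
  commutator of \<open>B\<close> and \<open>S\<close>. Expanding its trace in entries gives the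
  weights \<open>mu k - mu i\<close>, whose signs match those of the two triangles of
  \<open>F_field\<close>.\<close>

lemma weighted_form_F_field:
  fixes mu :: "'n::{finite,linorder} \<Rightarrow> real"
    and A p v :: "real^'n::{finite,linorder}^'n::{finite,linorder}"
  assumes mu: "\<And>i j. i < j \<Longrightarrow> mu j < mu i" and A: "transpose A = A"
    and p: "p \<in> orthogonal_group" and skew: "transpose (transpose p ** v) = - (transpose p ** v)"
  shows "weighted_form mu (transpose p ** F_field A p) (transpose p ** v)
    = trace (diag_mat mu ** (transpose p ** A ** v + transpose v ** A ** p))"
proof -
  define B where "B = transpose p ** A ** p"
  define S where "S = transpose p ** v"
  have v: "v = p ** S" "transpose v = - S ** transpose p"
  proof -
    show "v = p ** S"
      by (simp add: S_def matrix_mul_assoc orthogonal_group_inverse[OF p])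
    from arg_cong[OF this, of transpose] show "transpose v = - S ** transpose p"
      using skew by (simp add: matrix_transpose_mul[of p S]) (simp add: S_def)
  qed
  have Bsym: "B $ b $ a = B $ a $ b" for a b
  proof -
    have "transpose B = B"
      by (simp add: B_def matrix_transpose_mul A matrix_mul_assoc)
    from arg_cong[OF this, of "\<lambda>X. X $ a $ b"] show ?thesis by (simp add: transpose_def)
  qed
  note Sskew = skew_entry[OF skew, folded S_def]
  have "trace (diag_mat mu ** (transpose p ** A ** v + transpose v ** A ** p))
      = trace (diag_mat mu ** (B ** S)) - trace (diag_mat mu ** (S ** B))"
    unfolding v(2) unfolding v(1)
    by (simp add: B_def matrix_mul_assoc matrix_expand trace_add trace_sub)
  also have "\<dots> = (\<Sum>i\<in>UNIV. \<Sum>k\<in>UNIV. mu i * B $ i $ k * S $ k $ i)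
      - (\<Sum>i\<in>UNIV. \<Sum>k\<in>UNIV. mu i * S $ i $ k * B $ k $ i)"
    by (simp add: trace_diag_mat_mult matrix_mult_entry sum_distrib_left mult.assoc)
  also have "(\<Sum>i\<in>UNIV. \<Sum>k\<in>UNIV. mu i * S $ i $ k * B $ k $ i)
      = (\<Sum>i\<in>UNIV. \<Sum>k\<in>UNIV. mu k * S $ k $ i * B $ i $ k)"
    \<comment> \<open>Exchanging the roles of \<open>i\<close> and \<open>k\<close> makes both
      double sums run over products of the same two entries, so they can be subtracted
      termwise.\<close>
    by (rule sum.swap)
  also have "(\<Sum>i\<in>UNIV. \<Sum>k\<in>UNIV. mu i * B $ i $ k * S $ k $ i)
      - (\<Sum>i\<in>UNIV. \<Sum>k\<in>UNIV. mu k * S $ k $ i * B $ i $ k)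
      = (\<Sum>i\<in>UNIV. \<Sum>k\<in>UNIV. (mu k - mu i) * B $ i $ k * S $ i $ k)"
  proof -
    have "mu i * B $ i $ k * S $ k $ i - mu k * S $ k $ i * B $ i $ k
        = (mu k - mu i) * B $ i $ k * S $ i $ k" for i k
      using Sskew[of k i] by (simp add: algebra_simps)
    then show ?thesis
      by (simp only: sum_subtractf[symmetric])
  qed
  also have "\<dots> = weighted_form mu
      (\<chi> a b. if b < a then B $ a $ b else if a < b then - B $ a $ b else 0) S"
    unfolding weighted_form_def
  proof (intro sum.cong refl)
    fix i k :: 'n
    show "(mu k - mu i) * B $ i $ k * S $ i $ k = \<bar>mu i - mu k\<bar> *
        (\<chi> a b. if b < a then B $ a $ b else if a < b then - B $ a $ b else 0) $ i $ k * S $ i $ k"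
      \<comment> \<open>As \<open>mu\<close> decreases, \<open>mu k - mu i\<close> is negative for
        \<open>i < k\<close>, where the triangular matrix carries a minus sign, and positive for
        \<open>k < i\<close>; on the diagonal both sides vanish.\<close>
      using mu[of i k] mu[of k i] by (cases i k rule: linorder_cases) (auto simp: algebra_simps)
  qed
  also have "\<dots> = weighted_form mu (transpose p ** F_field A p) (transpose p ** v)"
    unfolding F_field_eq_triangular B_def S_def
    by (simp add: matrix_mul_assoc orthogonal_group_inverse[OF p])
  finally show ?thesis by simp
qed

section \<open>The metric and its gradient\<close>

theorem theorem4p1:
  fixes lam mu :: "'n::{finite,linorder} \<Rightarrow> real"
    and A N :: "real^'n::{finite,linorder}^'n::{finite,linorder}"
    and M :: "(real^'n::{finite,linorder}^'n::{finite,linorder}) set"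
  assumes lam_decreasing: "\<And>i j. i < j \<Longrightarrow> lam j < lam i"
    and lam_pos: "\<And>i. 0 < lam i"
    and mu_decreasing: "\<And>i j. i < j \<Longrightarrow> mu j < mu i"
    and A: "A = diag_mat lam"
    and N: "N = diag_mat mu"
    and M: "M = orthogonal_group - signed_permutations"
  shows "\<exists>g. riemannian_metric_on M g \<and>
           has_riemannian_gradient_on M g (\<lambda>Q. - energy A N Q) (\<lambda>Q. - F_field A Q)"
proof -
  \<comment> \<open>On \<open>M\<close> the transpose of \<open>p\<close> is its inverse, so tangent
    vectors are moved back to skew matrices. The formula is polynomial in all arguments and makes
    sense at every matrix \<open>p\<close>.\<close>
  define g where "g p u v = weighted_form mu (transpose p ** u) (transpose p ** v)"
    for p u v :: "real^'n::{finite,linorder}^'n::{finite,linorder}"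
  interpret wf: bounded_bilinear "weighted_form mu"
    by (rule bounded_bilinear_weighted_form)
  have skew: "transpose (transpose p ** v) = - (transpose p ** v)" if "v \<in> tangent_space M p" for p v
    using that smooth_curve_through_skew[of M p v] by (auto simp: tangent_space_def M)
  have Asym: "transpose A = A"
    by (auto simp: A diag_mat_def transpose_def vec_eq_iff)
  have mu_inj: "inj mu"
    by (rule injI) (metis less_irrefl linorder_less_linear mu_decreasing)
  have "inner_product_on_subspace (tangent_space M p) (g p)" if "p \<in> M" for p
    unfolding inner_product_on_subspace_def
  proof (intro conjI ballI allI impI)
    show "g p (r *\<^sub>R u + s *\<^sub>R v) w = r * g p u w + s * g p v w" for u v w r s
      by (simp add: g_def matrix_expand wf.add_left wf.scaleR_left)
    show "g p u v = g p v u" for u v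
      by (simp add: g_def weighted_form_def mult_ac)
    show "g p u u > 0" if u: "u \<in> tangent_space M p" "u \<noteq> 0" for u
    proof -
      \<comment> \<open>Moving back to the identity is injective, so positivity of the form on
        nonzero skew matrices carries over.\<close>
      have "u = p ** (transpose p ** u)"
        using \<open>p \<in> M\<close> by (simp add: M matrix_mul_assoc orthogonal_group_inverse)
      then have "transpose p ** u \<noteq> 0"
        using u(2) by (metis bounded_bilinear.zero_right[OF bounded_bilinear_matrix_mult])
      then show ?thesis
        unfolding g_def by (intro weighted_form_pos mu_inj skew u)
    qed
  qed
  moreover have "smooth_map_on M (\<lambda>p. g p (X p) (Y p))"
    if X: "smooth_vector_field_on M X" and Y: "smooth_vector_field_on M Y" for X Y
    unfolding smooth_map_on_def
  proof
    fix p assume "p \<in> M"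
    obtain U h where U: "open U" "p \<in> U" "smooth_on U h" "\<forall>x\<in>U \<inter> M. h x = X x"
      using X \<open>p \<in> M\<close> unfolding smooth_vector_field_on_def smooth_map_on_def by meson
    obtain V k where V: "open V" "p \<in> V" "smooth_on V k" "\<forall>x\<in>V \<inter> M. k x = Y x"
      using Y \<open>p \<in> M\<close> unfolding smooth_vector_field_on_def smooth_map_on_def by meson
    have "open (U \<inter> V)" using U V by auto
    \<comment> \<open>Since \<open>g\<close> is given in the ambient space, inserting the local
      extensions \<open>h\<close> and \<open>k\<close> of the two fields extends the pairing
      smoothly.\<close>
    then have "k_smooth_on m (U \<inter> V) (\<lambda>x. g x (h x) (k x))" for m
      unfolding g_def using U V
      by (intro k_smooth_on_bilinear[OF bounded_bilinear_weighted_form]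
          k_smooth_on_bilinear[OF bounded_bilinear_transpose_mult] k_smooth_on_id)
        (auto simp: smooth_on_def intro: k_smooth_on_subset)
    then show "\<exists>W f. open W \<and> p \<in> W \<and> smooth_on W f \<and> (\<forall>x\<in>W \<inter> M. f x = g x (X x) (Y x))"
      using U V \<open>open (U \<inter> V)\<close>
      by (intro exI[of _ "U \<inter> V"] exI[of _ "\<lambda>x. g x (h x) (k x)"]) (auto simp: smooth_on_def)
  qed
  moreover have "- F_field A p \<in> tangent_space M p" if "p \<in> M" for p
  proof -
    define B where "B = transpose p ** A ** p"
    define S where "S = (\<chi> a b. if b < a then B $ a $ b else if a < b then - B $ a $ b else 0)"
    \<comment> \<open>Symmetry of \<open>B\<close> makes the signed triangular matrix
      \<open>S\<close> skew, which is what tangency of \<open>F_field\<close> requires.\<close>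
    have "transpose B = B"
      by (simp add: B_def matrix_transpose_mul Asym matrix_mul_assoc)
    then have "B $ b $ a = B $ a $ b" for a b
      by (metis transpose_def vec_lambda_beta)
    then have "transpose (- S) = - (- S)"
      by (auto simp: S_def transpose_def vec_eq_iff)
    then have "p ** (- S) \<in> tangent_space M p"
      using skew_in_tangent_space that unfolding M by blast
    then show ?thesis
      unfolding F_field_eq_triangular S_def B_def by (simp add: matrix_expand)
  qed
  moreover have "((\<lambda>t. - energy A N (\<gamma> t)) has_real_derivative g p (- F_field A p) v) (at 0)"
    if "p \<in> M" "smooth_curve_through M p v \<gamma>" for p v \<gamma>
  proof -
    have "v \<in> tangent_space M p"
      using that by (auto simp: tangent_space_def)
    \<comment> \<open>The differential of the energy is thus represented by \<open>F_field\<close>;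
      negating both yields the claim.\<close>
    then have "trace (N ** (transpose p ** A ** v + transpose v ** A ** p)) = g p (F_field A p) v"
      using that(1) by (simp add: g_def N M weighted_form_F_field mu_decreasing Asym skew)
    then have "((\<lambda>t. energy A N (\<gamma> t)) has_real_derivative g p (F_field A p) v) (at 0)"
      using energy_derivative[of \<gamma> v 0 p A N] that(2) by (auto simp: smooth_curve_through_def)
    from DERIV_minus[OF this] show ?thesis
      by (simp add: g_def matrix_expand wf.minus_left)
  qed
  ultimately show ?thesis
    unfolding riemannian_metric_on_def has_riemannian_gradient_on_def by blast
qed

end
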